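(* Let $n\geq 3$ be an integer and let $n=p_1^{e_1}p_2^{e_2}\cdots p_k^{e_k}$ be its prime factorization, where $p_1,\ldots,p_k$ are distinct primes and $e_1,e_2,\ldots,e_k\in\mathbb Z^+$. Then $\iota(D_{2n})=k+1$.
   Context: $D_{2n}=\langle r,s : r^n=1=s^2,\ r^{-1}=srs\rangle$ denotes the dihedral group of order $2n$, where $n\geq 3$. The Frattini subgroup $\Phi(G)$ of a finite group $G$ is the intersection of all maximal subgroups of $G$. For a nontrivial finite group $G$, the intersection number $\iota(G)$ is the minimum number of maximal subgroups of $G$ whose intersection equals $\Phi(G)$. *)

theory Defs
  imports "HOL-Algebra.Generated_Groups" "HOL-Number_Theory.Cong" "HOL-Computational_Algebra.Primes"
begin

section \<open>Groups given by generators and relations\<close>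

text \<open>A word is a list of letters; \<open>(x, True)\<close> stands for the generator \<open>x\<close> and
  \<open>(x, False)\<close> for its formal inverse.\<close>

type_synonym 'x word = "('x \<times> bool) list"

inductive pres_eq :: "('x word \<times> 'x word) set \<Rightarrow> 'x word \<Rightarrow> 'x word \<Rightarrow> bool"
  for R :: "('x word \<times> 'x word) set"
  where
    pres_refl: "pres_eq R u u"
  | pres_sym: "pres_eq R u v \<Longrightarrow> pres_eq R v u"
  | pres_trans: "pres_eq R u v \<Longrightarrow> pres_eq R v w \<Longrightarrow> pres_eq R u w"
  | pres_append: "pres_eq R u v \<Longrightarrow> pres_eq R u' v' \<Longrightarrow> pres_eq R (u @ u') (v @ v')"
  | pres_cancel: "pres_eq R [(x, b), (x, \<not> b)] []"
  | pres_rel: "(u, v) \<in> R \<Longrightarrow> pres_eq R u v"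

definition pres_class :: "('x word \<times> 'x word) set \<Rightarrow> 'x word \<Rightarrow> 'x word set"
  where "pres_class R u = {v. pres_eq R u v}"

text \<open>The group with generating set the type \<open>'x\<close> and defining relations
  \<open>u = v\<close> for \<open>(u, v) \<in> R\<close>.\<close>

definition presented_group :: "('x word \<times> 'x word) set \<Rightarrow> 'x word set monoid"
  where "presented_group R =
    \<lparr>carrier = range (pres_class R),
     monoid.mult = (\<lambda>A B. \<Union>u\<in>A. \<Union>v\<in>B. pres_class R (u @ v)),
     one = pres_class R []\<rparr>"

lemma pres_class_eq_iff: "pres_class R u = pres_class R v \<longleftrightarrow> pres_eq R u v"
  unfolding pres_class_def by (blast intro: pres_refl pres_sym pres_trans)

lemma pres_mult:
  "pres_class R u \<otimes>\<^bsub>presented_group R\<^esub> pres_class R v = pres_class R (u @ v)"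
proof -
  have eq: "pres_class R (u' @ v') = pres_class R (u @ v)"
    if "u' \<in> pres_class R u" "v' \<in> pres_class R v" for u' v'
  proof -
    from that have "pres_eq R u u'" "pres_eq R v v'" by (simp_all only: pres_class_def mem_Collect_eq)
    from pres_append[OF this] show ?thesis
      unfolding pres_class_eq_iff by (rule pres_sym)
  qed
  have mem: "w \<in> pres_class R w" for w
    unfolding pres_class_def by (simp only: mem_Collect_eq pres_refl)
  have "(\<Union>u'\<in>pres_class R u. \<Union>v'\<in>pres_class R v. pres_class R (u' @ v')) = pres_class R (u @ v)"
    using eq mem by blast
  then show ?thesis
    by (simp only: presented_group_def monoid.simps)
qed

lemma pres_left_inverse: "\<exists>v. pres_eq R (v @ u) []"
proof (induction u)
  case Nil
  show ?case using pres_refl[of R "[]"] by (intro exI[of _ "[]"]) simp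
next
  case (Cons a u)
  obtain x b where a: "a = (x, b)" by fastforce
  obtain v where v: "pres_eq R (v @ u) []" using Cons by blast
  have "pres_eq R ([(x, \<not> b), (x, b)] @ u) ([] @ u)"
    using pres_cancel[of R x "\<not> b"] by (intro pres_append pres_refl) simp
  from pres_append[OF pres_refl[of R v] this]
  have "pres_eq R ((v @ [(x, \<not> b)]) @ a # u) (v @ u)" by (simp add: a)
  then show ?case using v pres_trans by blast
qed

lemma group_presented_group: "group (presented_group R)"
proof (rule groupI)
  have C: "carrier (presented_group R) = range (pres_class R)"
    and O: "\<one>\<^bsub>presented_group R\<^esub> = pres_class R []"
    by (simp_all add: presented_group_def)
  show "\<one>\<^bsub>presented_group R\<^esub> \<in> carrier (presented_group R)"
    by (simp add: C O)
  fix A assume "A \<in> carrier (presented_group R)"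
  then obtain u where A: "A = pres_class R u" by (auto simp: C)
  show "\<one>\<^bsub>presented_group R\<^esub> \<otimes>\<^bsub>presented_group R\<^esub> A = A"
    by (simp add: A O pres_mult)
  show "\<exists>B\<in>carrier (presented_group R). B \<otimes>\<^bsub>presented_group R\<^esub> A = \<one>\<^bsub>presented_group R\<^esub>"
    using pres_left_inverse[of R u] by (auto simp: A C O pres_mult pres_class_eq_iff)
  fix B assume "B \<in> carrier (presented_group R)"
  then obtain v where B: "B = pres_class R v" by (auto simp: C)
  show "A \<otimes>\<^bsub>presented_group R\<^esub> B \<in> carrier (presented_group R)"
    by (simp add: A B C pres_mult)
  fix D assume "D \<in> carrier (presented_group R)"
  then obtain w where D: "D = pres_class R w" by (auto simp: C)
  show "A \<otimes>\<^bsub>presented_group R\<^esub> B \<otimes>\<^bsub>presented_group R\<^esub> D =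
        A \<otimes>\<^bsub>presented_group R\<^esub> (B \<otimes>\<^bsub>presented_group R\<^esub> D)"
    by (simp add: A B D pres_mult)
qed


section \<open>Dihedral groups\<close>

datatype dihedral_gen = Rot | Ref

definition dihedral_rels :: "nat \<Rightarrow> (dihedral_gen word \<times> dihedral_gen word) set"
  where "dihedral_rels n =
    (let r = (Rot, True); r' = (Rot, False); s = (Ref, True)
     in {(replicate n r, []), ([s, s], []), ([r'], [s, r, s])})"

text \<open>\<open>n\<close> is the order of the rotation: this is the group usually written \<open>D\<^sub>2\<^sub>n\<close>.\<close>

definition dihedral_group :: "nat \<Rightarrow> dihedral_gen word set monoid"
  where "dihedral_group n = presented_group (dihedral_rels n)"

lemma group_dihedral_group: "group (dihedral_group n)"
  unfolding dihedral_group_def by (rule group_presented_group)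

text \<open>The value of a word, read as \<open>r ^ i\<close> or \<open>r ^ i s\<close>, in the infinite dihedral group.\<close>

fun dih_mult :: "int \<times> bool \<Rightarrow> int \<times> bool \<Rightarrow> int \<times> bool"
  where "dih_mult (i, x) (j, y) = (if x then i - j else i + j, x \<noteq> y)"

fun dih_letter :: "dihedral_gen \<times> bool \<Rightarrow> int \<times> bool"
  where
    "dih_letter (Rot, b) = (if b then 1 else - 1, False)"
  | "dih_letter (Ref, b) = (0, True)"

fun dih_val :: "dihedral_gen word \<Rightarrow> int \<times> bool"
  where
    "dih_val [] = (0, False)"
  | "dih_val (a # w) = dih_mult (dih_letter a) (dih_val w)"

lemma dih_val_append: "dih_val (u @ v) = dih_mult (dih_val u) (dih_val v)"
proof (induction u)
  case Nil
  show ?case by (cases "dih_val v") simp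
next
  case (Cons a u)
  then show ?case
    by (cases "dih_letter a"; cases "dih_val u"; cases "dih_val v") auto
qed

lemma dih_val_replicate: "dih_val (replicate m (Rot, True)) = (int m, False)"
  by (induction m) auto

lemma dih_val_cong:
  assumes "pres_eq (dihedral_rels n) u v"
  shows "[fst (dih_val u) = fst (dih_val v)] (mod int n) \<and> snd (dih_val u) = snd (dih_val v)"
  using assms
proof (induction rule: pres_eq.induct)
  case (pres_sym u v)
  then show ?case by (simp add: cong_sym)
next
  case (pres_trans u v w)
  then show ?case by (metis cong_trans)
next
  case (pres_append u v u' v')
  then show ?case
    by (cases "dih_val u"; cases "dih_val u'"; cases "dih_val v"; cases "dih_val v'")
       (auto simp: dih_val_append intro: cong_add cong_diff)
next
  case (pres_cancel x b)
  show ?case by (cases x) auto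
next
  case (pres_rel u v)
  then consider "u = replicate n (Rot, True)" "v = []"
    | "u = [(Ref, True), (Ref, True)]" "v = []"
    | "u = [(Rot, False)]" "v = [(Ref, True), (Rot, True), (Ref, True)]"
    unfolding dihedral_rels_def Let_def by blast
  then show ?case
    by cases (simp_all add: dih_val_replicate cong_def)
qed simp

definition dih_nf :: "nat \<times> bool \<Rightarrow> dihedral_gen word"
  where "dih_nf p = replicate (fst p) (Rot, True) @ (if snd p then [(Ref, True)] else [])"

lemma dih_val_nf: "dih_val (dih_nf (i, b)) = (int i, b)"
  by (auto simp: dih_nf_def dih_val_append dih_val_replicate)

lemma dih_nf_exists:
  assumes "0 < n"
  shows "\<exists>i<n. \<exists>b. pres_eq (dihedral_rels n) u (dih_nf (i, b))"
proof -
  let ?R = "dihedral_rels n"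
  let ?r = "(Rot, True)" and ?r' = "(Rot, False)" and ?s = "(Ref, True)" and ?s' = "(Ref, False)"
  have L: "pres_eq ?R (a @ x @ b) (a @ y @ b)" if "pres_eq ?R x y" for a b x y
    using that by (intro pres_append pres_refl)
  have rn: "pres_eq ?R (replicate n ?r) []" and ss: "pres_eq ?R [?s, ?s] []"
    and rs: "pres_eq ?R [?r'] [?s, ?r, ?s]"
    by (rule pres_rel, simp add: dihedral_rels_def Let_def)+
  have rr': "pres_eq ?R [?r, ?r'] []" using pres_cancel[of ?R Rot True] by simp
  have r'r: "pres_eq ?R [?r', ?r] []" using pres_cancel[of ?R Rot False] by simp
  have s's: "pres_eq ?R [?s', ?s] []" using pres_cancel[of ?R Ref False] by simp
  have s': "pres_eq ?R [?s'] [?s]"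
    using pres_trans[OF pres_sym[OF L[OF ss, of "[?s']" "[]"]]] L[OF s's, of "[]" "[?s]"]
    by simp
  have r': "pres_eq ?R [?r'] (replicate (n - 1) ?r)"
  proof -
    have "replicate n ?r = ?r # replicate (n - 1) ?r"
      using assms by (cases n) auto
    with pres_trans[OF pres_sym[OF L[OF rn, of "[?r']" "[]"]]] L[OF r'r, of "[]" "replicate (n - 1) ?r"]
    show ?thesis by simp
  qed
  have sr: "pres_eq ?R [?s, ?r] (replicate (n - 1) ?r @ [?s])"
    using pres_trans[OF pres_sym[OF L[OF ss, of "[?s, ?r]" "[]"]]]
      pres_trans[OF pres_sym[OF L[OF rs, of "[]" "[?s]"]] L[OF r', of "[]" "[?s]"]]
    by simp
  have red: "\<exists>i<n. pres_eq ?R (replicate m ?r) (replicate i ?r)" for m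
  proof (induction m rule: less_induct)
    case (less m)
    show ?case
    proof (cases "m < n")
      case True
      then show ?thesis using pres_refl by blast
    next
      case False
      then have "replicate m ?r = replicate n ?r @ replicate (m - n) ?r"
        by (simp flip: replicate_add)
      with L[OF rn, of "[]" "replicate (m - n) ?r"]
      have "pres_eq ?R (replicate m ?r) (replicate (m - n) ?r)" by simp
      moreover obtain i where "i < n" "pres_eq ?R (replicate (m - n) ?r) (replicate i ?r)"
        using less[of "m - n"] False assms by force
      ultimately show ?thesis using pres_trans by blast
    qed
  qed
  have rednf: "\<exists>i<n. \<exists>b. pres_eq ?R u (dih_nf (i, b))" if "pres_eq ?R u (dih_nf (m, b))" for u m b
  proof -
    obtain i where i: "i < n" "pres_eq ?R (replicate m ?r) (replicate i ?r)"
      using red by blast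
    then have "pres_eq ?R (dih_nf (m, b)) (dih_nf (i, b))"
      using pres_append[OF i(2) pres_refl] by (simp add: dih_nf_def)
    with i that show ?thesis using pres_trans by blast
  qed
  have shift: "\<exists>m. pres_eq ?R (?s # replicate i ?r) (replicate m ?r @ [?s])" for i
  proof (induction i)
    case 0
    show ?case using pres_refl[of ?R "[?s]"] by (intro exI[of _ 0]) simp
  next
    case (Suc i)
    then obtain m where m: "pres_eq ?R (?s # replicate i ?r) (replicate m ?r @ [?s])" by blast
    have "pres_eq ?R (?s # replicate (Suc i) ?r) (replicate (n - 1) ?r @ ?s # replicate i ?r)"
      using L[OF sr, of "[]" "replicate i ?r"] by simp
    moreover have "pres_eq ?R (replicate (n - 1) ?r @ ?s # replicate i ?r)
        (replicate (n - 1 + m) ?r @ [?s])"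
      using L[OF m, of "replicate (n - 1) ?r" "[]"] by (simp add: replicate_add)
    ultimately show ?case using pres_trans by blast
  qed
  have step: "\<exists>m b'. pres_eq ?R (a # dih_nf (i, b)) (dih_nf (m, b'))" for a i b
  proof -
    have R: "\<exists>m b'. pres_eq ?R (?s # dih_nf (i, b)) (dih_nf (m, b'))"
    proof -
      obtain m where m: "pres_eq ?R (?s # replicate i ?r) (replicate m ?r @ [?s])"
        using shift by blast
      show ?thesis
      proof (cases b)
        case True
        have "pres_eq ?R (?s # dih_nf (i, b)) (replicate m ?r @ [?s, ?s])"
          using L[OF m, of "[]" "[?s]"] True by (simp add: dih_nf_def)
        moreover have "pres_eq ?R (replicate m ?r @ [?s, ?s]) (dih_nf (m, False))"
          using L[OF ss, of "replicate m ?r" "[]"] by (simp add: dih_nf_def)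
        ultimately show ?thesis using pres_trans by blast
      next
        case False
        then have "pres_eq ?R (?s # dih_nf (i, b)) (dih_nf (m, True))"
          using m by (simp add: dih_nf_def)
        then show ?thesis by blast
      qed
    qed
    consider "a = ?r" | "a = ?r'" | "a = ?s" | "a = ?s'"
      by (cases a; cases "fst a"; cases "snd a") auto
    then show ?thesis
    proof cases
      case 1
      have "a # dih_nf (i, b) = dih_nf (Suc i, b)" by (simp add: 1 dih_nf_def)
      then show ?thesis using pres_refl by metis
    next
      case 2
      have "pres_eq ?R (a # dih_nf (i, b)) (dih_nf (n - 1 + i, b))"
        using L[OF r', of "[]" "dih_nf (i, b)"] by (simp add: 2 dih_nf_def replicate_add)
      then show ?thesis by blast
    next
      case 3
      then show ?thesis using R by simp
    next
      case 4
      have "pres_eq ?R (a # dih_nf (i, b)) (?s # dih_nf (i, b))"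
        using L[OF s', of "[]" "dih_nf (i, b)"] by (simp add: 4)
      then show ?thesis using R pres_trans by blast
    qed
  qed
  show ?thesis
  proof (induction u)
    case Nil
    show ?case
      using assms pres_refl[of ?R "[]"] by (intro exI[of _ 0] exI[of _ False] conjI) (auto simp: dih_nf_def)
  next
    case (Cons a u)
    then obtain i b where "pres_eq ?R u (dih_nf (i, b))" by blast
    then have "pres_eq ?R (a # u) (a # dih_nf (i, b))"
      using L[of u _ "[a]" "[]"] by simp
    moreover obtain m b' where "pres_eq ?R (a # dih_nf (i, b)) (dih_nf (m, b'))"
      using step by blast
    ultimately show ?case using rednf pres_trans by blast
  qed
qed

lemma dihedral_group_bij:
  assumes "0 < n"
  shows "bij_betw (\<lambda>p. pres_class (dihedral_rels n) (dih_nf p)) ({..<n} \<times> UNIV)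
           (carrier (dihedral_group n))"
  unfolding bij_betw_def
proof
  show "inj_on (\<lambda>p. pres_class (dihedral_rels n) (dih_nf p)) ({..<n} \<times> UNIV)"
  proof (rule inj_onI)
    fix p q :: "nat \<times> bool"
    assume p: "p \<in> {..<n} \<times> UNIV" and q: "q \<in> {..<n} \<times> UNIV"
      and e: "pres_class (dihedral_rels n) (dih_nf p) = pres_class (dihedral_rels n) (dih_nf q)"
    obtain i b j c where [simp]: "p = (i, b)" "q = (j, c)" by (cases p, cases q) auto
    from dih_val_cong[of n "dih_nf p" "dih_nf q"] e
    have "[int i = int j] (mod int n)" "b = c"
      by (auto simp: pres_class_eq_iff dih_val_nf)
    then show "p = q" using p q by (auto simp: cong_def zmod_int[symmetric])
  qed
  show "(\<lambda>p. pres_class (dihedral_rels n) (dih_nf p)) ` ({..<n} \<times> UNIV) = carrier (dihedral_group n)"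
    using dih_nf_exists[OF assms]
    by (fastforce simp: dihedral_group_def presented_group_def image_iff pres_class_eq_iff)
qed

lemma order_dihedral_group: "0 < n \<Longrightarrow> order (dihedral_group n) = 2 * n"
  using bij_betw_same_card[OF dihedral_group_bij, of n]
  by (simp add: order_def card_cartesian_product)


section \<open>Maximal subgroups, Frattini subgroup and intersection number\<close>

definition maximal_subgroup :: "'a set \<Rightarrow> ('a, 'b) monoid_scheme \<Rightarrow> bool"
  where "maximal_subgroup M G \<longleftrightarrow> subgroup M G \<and> M \<noteq> carrier G \<and>
    (\<forall>H. subgroup H G \<longrightarrow> M \<subseteq> H \<longrightarrow> H = M \<or> H = carrier G)"

text \<open>Intersections are taken inside the carrier, so that the empty family yields the whole
  group rather than \<open>UNIV\<close>.\<close>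

definition frattini :: "('a, 'b) monoid_scheme \<Rightarrow> 'a set"
  where "frattini G = carrier G \<inter> \<Inter> {M. maximal_subgroup M G}"

text \<open>Meaningful for nontrivial finite groups only. There the empty family never qualifies,
  since the Frattini subgroup is proper. Finiteness of \<open>S\<close> is stated because
  \<open>card\<close> of an infinite set is \<open>0\<close>.\<close>

definition intersection_number :: "('a, 'b) monoid_scheme \<Rightarrow> nat"
  where "intersection_number G =
    (LEAST m. \<exists>S. S \<subseteq> {M. maximal_subgroup M G} \<and> finite S \<and> card S = m \<and>
       carrier G \<inter> \<Inter> S = frattini G)"

end

theory Submission
  imports Defs
begin

text \<open>The maximal subgroups are the rotation subgroup and, for each prime \<open>p\<close> dividing \<open>n\<close> and each
  residue \<open>a\<close> modulo \<open>p\<close>, the subgroup \<open>\<langle>r\<^sup>p, r\<^sup>a s\<rangle>\<close>. So the Frattini subgroup consists of the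
  \<open>r\<^sup>i\<close> with \<open>i\<close> divisible by all primes dividing \<open>n\<close>. A family with this intersection needs a
  subgroup of the second kind for each prime, since otherwise a rotation by the product of the
  other primes survives; and one subgroup for each prime is not enough, since the Chinese remainder
  theorem gives a reflection lying in all of them.\<close>

section \<open>Subgroups of the integers\<close>

text \<open>Division with remainder: the least positive element divides every other, because the
  remainder stays in \<open>A\<close>. The value \<open>d = 0\<close> covers \<open>A = {0}\<close>.
  Applied below to the exponents of the rotations in a subgroup.\<close>

lemma int_subgroup_cyclic:
  fixes A :: "int set"
  assumes "A \<noteq> {}" and diff: "\<And>x y. x \<in> A \<Longrightarrow> y \<in> A \<Longrightarrow> x - y \<in> A"
  obtains d where "A = {x. d dvd x}"
proof -
  have zero: "0 \<in> A" using assms by (metis all_not_in_conv diff_self)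
  have neg: "- x \<in> A" if "x \<in> A" for x using diff[OF zero that] by simp
  have add: "x + y \<in> A" if "x \<in> A" "y \<in> A" for x y using diff[OF that(1) neg[OF that(2)]] by simp
  have natmult: "int m * x \<in> A" if "x \<in> A" for m x
    by (induction m) (use zero add that in \<open>auto simp: algebra_simps\<close>)
  have mult: "m * x \<in> A" if "x \<in> A" for m x
    by (cases m rule: int_cases2) (use natmult[OF that] neg in auto)
  have pos: "nat \<bar>x\<bar> > 0 \<and> int (nat \<bar>x\<bar>) \<in> A" if "x \<in> A" "x \<noteq> 0" for x
    using that neg by (auto simp: abs_if)
  show ?thesis
  proof (cases "A = {0}")
    case True
    then show ?thesis by (intro that[of 0]) auto
  next
    case False
    then obtain x where "x \<in> A" "x \<noteq> 0" using zero by blast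
    define d where "d = (LEAST d. d > 0 \<and> int d \<in> A)"
    have d: "d > 0" "int d \<in> A"
      using LeastI[of "\<lambda>d. d > 0 \<and> int d \<in> A", OF pos[OF \<open>x \<in> A\<close> \<open>x \<noteq> 0\<close>]] by (auto simp: d_def)
    have least: "d \<le> m" if "m > 0" "int m \<in> A" for m
      unfolding d_def using that by (intro Least_le) auto
    have "int d dvd y" if "y \<in> A" for y
    proof -
      have "y mod int d \<in> A"
        unfolding minus_div_mult_eq_mod[symmetric] using that d(2) by (intro diff mult)
      moreover have "y mod int d \<ge> 0" "y mod int d < int d" using d(1) by auto
      ultimately have "y mod int d = 0" using least[of "nat (y mod int d)"] by force
      then show ?thesis by auto
    qed
    moreover have "y \<in> A" if "int d dvd y" for y
      using that mult[OF d(2)] by (auto simp: dvd_def mult.commute)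
    ultimately show ?thesis by (intro that[of "int d"]) auto
  qed
qed

section \<open>Integer coordinates on the dihedral group\<close>

text \<open>Both words reduce to normal forms with exponents below \<open>n\<close>, where congruent
  exponents coincide. This solves the word problem, so that computing in the group becomes
  arithmetic modulo \<open>n\<close>.\<close>

lemma pres_eq_dihedral_iff:
  assumes "0 < n"
  shows "pres_eq (dihedral_rels n) u v \<longleftrightarrow>
    [fst (dih_val u) = fst (dih_val v)] (mod int n) \<and> snd (dih_val u) = snd (dih_val v)"
    (is "_ \<longleftrightarrow> ?C u v")
proof
  assume C: "?C u v"
  obtain i b where i: "i < n" "pres_eq (dihedral_rels n) u (dih_nf (i, b))"
    using dih_nf_exists[OF assms] by blast
  obtain j c where j: "j < n" "pres_eq (dihedral_rels n) v (dih_nf (j, c))"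
    using dih_nf_exists[OF assms] by blast
  have "[int i = int j] (mod int n)" "b = c"
    using dih_val_cong[OF i(2)] dih_val_cong[OF j(2)] C
    by (auto simp: dih_val_nf cong_def)
  then have "dih_nf (i, b) = dih_nf (j, c)"
    using i(1) j(1) by (simp add: cong_int_iff) (simp add: cong_def)
  then show "pres_eq (dihedral_rels n) u v"
    using i(2) j(2) pres_sym pres_trans by metis
qed (rule dih_val_cong)

text \<open>The rotation \<open>r\<^sup>i\<close> or the reflection \<open>r\<^sup>i s\<close>, with
  \<open>i\<close> any integer. Reducing modulo \<open>n\<close> supplies the natural exponent that
  \<open>dih_nf\<close> expects.\<close>

definition dih_elem :: "nat \<Rightarrow> int \<Rightarrow> bool \<Rightarrow> dihedral_gen word set"
  where "dih_elem n i b = pres_class (dihedral_rels n) (dih_nf (nat (i mod int n), b))"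

context
  fixes n :: nat
  assumes n: "0 < n"
begin

interpretation D: group "dihedral_group n"
  by (rule group_dihedral_group)

lemma pres_class_eq_dih_elem:
  "pres_class (dihedral_rels n) u = dih_elem n (fst (dih_val u)) (snd (dih_val u))"
  using n by (simp add: dih_elem_def pres_class_eq_iff pres_eq_dihedral_iff dih_val_nf)

lemma dih_elem_eq_iff: "dih_elem n i b = dih_elem n j c \<longleftrightarrow> [i = j] (mod int n) \<and> b = c"
  using n by (simp add: dih_elem_def pres_class_eq_iff pres_eq_dihedral_iff dih_val_nf cong_def)

text \<open>Moving \<open>s\<close> past a rotation inverts it, hence the difference of exponents
  when the left factor is a reflection.\<close>

lemma dih_elem_mult:
  "dih_elem n i b \<otimes>\<^bsub>dihedral_group n\<^esub> dih_elem n j c = dih_elem n (if b then i - j else i + j) (b \<noteq> c)"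
  using n unfolding dih_elem_def dihedral_group_def pres_mult
  by (auto simp: pres_class_eq_iff pres_eq_dihedral_iff dih_val_append dih_val_nf cong_def mod_simps)

lemma carrier_dihedral: "carrier (dihedral_group n) = {dih_elem n i b |i b. True}"
proof -
  have "carrier (dihedral_group n) = range (pres_class (dihedral_rels n))"
    by (simp add: dihedral_group_def presented_group_def)
  moreover have "dih_elem n i b \<in> range (pres_class (dihedral_rels n))" for i b
    by (simp add: dih_elem_def)
  ultimately show ?thesis by (auto simp: pres_class_eq_dih_elem)
qed

lemma dih_elem_carrier [simp]: "dih_elem n i b \<in> carrier (dihedral_group n)"
  by (auto simp: carrier_dihedral)

lemma dih_elem_one: "\<one>\<^bsub>dihedral_group n\<^esub> = dih_elem n 0 False"
  by (simp add: dihedral_group_def presented_group_def pres_class_eq_dih_elem)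

lemma dih_elem_inv: "inv\<^bsub>dihedral_group n\<^esub> dih_elem n i b = dih_elem n (if b then i else - i) b"
  by (rule D.inv_equality) (auto simp: dih_elem_mult dih_elem_one)

section \<open>The rotations in a subgroup\<close>

lemma dih_subset_iff:
  assumes "H \<subseteq> carrier (dihedral_group n)"
  shows "H \<subseteq> K \<longleftrightarrow> (\<forall>i b. dih_elem n i b \<in> H \<longrightarrow> dih_elem n i b \<in> K)"
  using assms by (fastforce simp: carrier_dihedral)

text \<open>Reflections are their own inverses, so two of them in \<open>H\<close> multiply to a
  rotation in \<open>H\<close>. Hence a single reflection and the rotations of \<open>H\<close>
  control all its reflections.\<close>

lemma subgroup_diff:
  assumes "subgroup H (dihedral_group n)" "dih_elem n i b \<in> H" "dih_elem n j b \<in> H"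
  shows "dih_elem n (i - j) False \<in> H"
  using subgroup.m_closed[OF assms(1,2) subgroup.m_inv_closed[OF assms(1,3)]]
  by (cases b) (simp_all add: dih_elem_inv dih_elem_mult)

text \<open>The rotation exponents are the multiples of some \<open>d\<close>, and \<open>d\<close>
  divides 1. Multiplying the given reflection by all rotations yields every reflection.\<close>

lemma subgroup_eq_carrierI:
  assumes H: "subgroup H (dihedral_group n)" and "dih_elem n 1 False \<in> H" "dih_elem n j True \<in> H"
  shows "H = carrier (dihedral_group n)"
proof -
  have ne: "{i. dih_elem n i False \<in> H} \<noteq> {}" using assms by auto
  obtain d where d: "{i. dih_elem n i False \<in> H} = {x. d dvd x}"
    by (rule int_subgroup_cyclic[OF ne]) (auto intro: subgroup_diff[OF H])
  have "1 \<in> {i. dih_elem n i False \<in> H}" using assms by simp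
  then have "d dvd 1" unfolding d by simp
  then have rot: "dih_elem n i False \<in> H" for i using d dvd_trans by blast
  have "dih_elem n i True \<in> H" for i
    using subgroup.m_closed[OF H rot[of "i - j"] assms(3)] by (simp add: dih_elem_mult)
  with rot have "dih_elem n i b \<in> H" for i b by (cases b) auto
  then show ?thesis
    using subgroup.subset[OF H] by (auto simp: carrier_dihedral)
qed

text \<open>The rotation exponents are the multiples of some \<open>d\<close>, which divides
  \<open>n\<close> because \<open>r\<^sup>n\<close> is the identity. Either \<open>d\<close> is a
  unit or it has a prime divisor \<open>p\<close>. This dichotomy drives both the maximality proof
  and the classification.\<close>

lemma subgroup_rotations_cases:
  assumes H: "subgroup H (dihedral_group n)"
  obtains "dih_elem n 1 False \<in> H"
  | p where "p \<in> prime_factors n" "\<And>i. dih_elem n i False \<in> H \<Longrightarrow> int p dvd i"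
proof -
  have one: "dih_elem n 0 False \<in> H"
    using subgroup.one_closed[OF H] by (simp add: dih_elem_one)
  then have ne: "{i. dih_elem n i False \<in> H} \<noteq> {}" by auto
  obtain d where d: "{i. dih_elem n i False \<in> H} = {x. d dvd x}"
    by (rule int_subgroup_cyclic[OF ne]) (auto intro: subgroup_diff[OF H])
  have "dih_elem n (int n) False = dih_elem n 0 False"
    by (simp add: dih_elem_eq_iff cong_def)
  with one d have dn: "d dvd int n" by auto
  show ?thesis
  proof (cases "nat \<bar>d\<bar> = 1")
    case True
    then have "1 \<in> {x. d dvd x}" by auto
    then show ?thesis using that(1) unfolding d[symmetric] by simp
  next
    case False
    then obtain p where p: "prime p" "p dvd nat \<bar>d\<bar>" using prime_factor_nat by blast
    then have pd: "int p dvd d" by (simp add: nat_dvd_iff flip: int_dvd_int_iff)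
    then have "p \<in> prime_factors n"
      using p(1) dn n by (metis prime_factors_dvd mem_Collect_eq dvd_trans int_dvd_int_iff
          in_prime_factors_iff not_gr0)
    then show ?thesis using d pd that(2) by (blast intro: dvd_trans)
  qed
qed

section \<open>The maximal subgroups\<close>

definition rotations :: "dihedral_gen word set set"
  where "rotations = range (\<lambda>i. dih_elem n i False)"

text \<open>The subgroup \<open>\<langle>r\<^sup>p, r\<^sup>a s\<rangle>\<close>.\<close>

definition dih_sub :: "nat \<Rightarrow> int \<Rightarrow> dihedral_gen word set set"
  where "dih_sub p a = {dih_elem n i b |i b. [i = (if b then a else 0)] (mod int p)}"

lemma dih_elem_rotations_iff [simp]: "dih_elem n i b \<in> rotations \<longleftrightarrow> \<not> b"
  by (auto simp: rotations_def dih_elem_eq_iff image_iff intro: cong_refl)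

text \<open>An exponent is determined only modulo \<open>n\<close>; as \<open>p\<close> divides
  \<open>n\<close>, the congruence modulo \<open>p\<close> does not depend on which exponent
  represents the element.\<close>

lemma dih_elem_sub_iff:
  assumes "p dvd n"
  shows "dih_elem n i b \<in> dih_sub p a \<longleftrightarrow> [i = (if b then a else 0)] (mod int p)"
proof -
  have "[i = j] (mod int p)" if "[i = j] (mod int n)" for i j
    using that assms by (meson cong_dvd_modulus int_dvd_int_iff)
  then show ?thesis
    by (auto simp: dih_sub_def dih_elem_eq_iff intro: cong_trans cong_refl)
qed

lemma subgroup_rotations: "subgroup rotations (dihedral_group n)"
  by (rule D.subgroupI) (auto simp: rotations_def dih_elem_mult dih_elem_inv)

lemma subgroup_dih_sub:
  assumes "p dvd n"
  shows "subgroup (dih_sub p a) (dihedral_group n)"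
proof (rule D.subgroupI)
  show sub: "dih_sub p a \<subseteq> carrier (dihedral_group n)" by (auto simp: dih_sub_def)
  have "dih_elem n 0 False \<in> dih_sub p a" by (simp add: dih_elem_sub_iff assms)
  then show "dih_sub p a \<noteq> {}" by blast
  fix x assume x: "x \<in> dih_sub p a"
  then obtain i b where xi: "x = dih_elem n i b" and i: "[i = (if b then a else 0)] (mod int p)"
    by (auto simp: dih_sub_def)
  show "inv\<^bsub>dihedral_group n\<^esub> x \<in> dih_sub p a"
    using i by (auto simp: xi dih_elem_inv dih_elem_sub_iff assms cong_0_iff)
  fix y assume "y \<in> dih_sub p a"
  then obtain j c where yj: "y = dih_elem n j c" and j: "[j = (if c then a else 0)] (mod int p)"
    by (auto simp: dih_sub_def)
  \<comment> \<open>Exponents add if \<open>x\<close> is a rotation and subtract if it is a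
    reflection, hence both congruences.\<close>
  show "x \<otimes>\<^bsub>dihedral_group n\<^esub> y \<in> dih_sub p a"
    using cong_add[OF i j] cong_diff[OF i j]
    by (auto simp: xi yj dih_elem_mult dih_elem_sub_iff assms split: if_splits)
qed

lemma maximal_rotations: "maximal_subgroup rotations (dihedral_group n)"
  unfolding maximal_subgroup_def
proof (intro conjI allI impI)
  show "subgroup rotations (dihedral_group n)" by (rule subgroup_rotations)
  show "rotations \<noteq> carrier (dihedral_group n)"
    using dih_elem_carrier[of 0 True] dih_elem_rotations_iff[of 0 True] by metis
  fix H assume H: "subgroup H (dihedral_group n)" and R: "rotations \<subseteq> H"
  show "H = rotations \<or> H = carrier (dihedral_group n)"
  proof (cases "\<exists>j. dih_elem n j True \<in> H")
    case True
    moreover have "dih_elem n 1 False \<in> H" using R by auto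
    ultimately show ?thesis using subgroup_eq_carrierI[OF H] by blast
  next
    case False
    have "H \<subseteq> rotations"
      unfolding dih_subset_iff[OF subgroup.subset[OF H]] using False by auto
    with R show ?thesis by blast
  qed
qed

text \<open>An overgroup contains \<open>r\<^sup>a s\<close>, so it is everything once it contains
  \<open>r\<close>. Otherwise some prime \<open>q\<close> divides all its rotation exponents;
  \<open>p\<close> is one of these, so \<open>q = p\<close> and nothing has been added.\<close>

lemma maximal_dih_sub:
  assumes "p \<in> prime_factors n"
  shows "maximal_subgroup (dih_sub p a) (dihedral_group n)"
  unfolding maximal_subgroup_def
proof (intro conjI allI impI)
  have p: "prime p" "p dvd n" using assms by (auto simp: in_prime_factors_iff)
  show "subgroup (dih_sub p a) (dihedral_group n)" by (rule subgroup_dih_sub[OF p(2)])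
  have "dih_elem n 1 False \<notin> dih_sub p a"
    using prime_gt_1_nat[OF p(1)] by (simp add: dih_elem_sub_iff p cong_0_iff)
  then show "dih_sub p a \<noteq> carrier (dihedral_group n)" using dih_elem_carrier by blast
  fix H assume H: "subgroup H (dihedral_group n)" and S: "dih_sub p a \<subseteq> H"
  have aH: "dih_elem n a True \<in> H" using S by (auto simp: dih_elem_sub_iff p)
  have pH: "dih_elem n (int p) False \<in> H"
    using S by (auto simp: dih_elem_sub_iff p cong_0_iff)
  from H show "H = dih_sub p a \<or> H = carrier (dihedral_group n)"
  proof (cases rule: subgroup_rotations_cases)
    case 1
    then show ?thesis using subgroup_eq_carrierI[OF H _ aH] by blast
  next
    case (2 q)
    have "q dvd p" using 2(2)[OF pH] by simp
    then have "q = p" using p(1) 2(1) by (simp add: in_prime_factors_iff primes_dvd_imp_eq)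
    \<comment> \<open>A reflection is compared with \<open>r\<^sup>a s\<close>: the exponents differ
      by that of a rotation in \<open>H\<close>, a multiple of \<open>p\<close>.\<close>
    have "dih_elem n i b \<in> dih_sub p a" if "dih_elem n i b \<in> H" for i b
      using 2(2)[of i] 2(2)[OF subgroup_diff[OF H _ aH], of i] that
      by (cases b) (auto simp: \<open>q = p\<close> dih_elem_sub_iff p cong_0_iff cong_iff_dvd_diff)
    then have "H \<subseteq> dih_sub p a" by (simp add: dih_subset_iff subgroup.subset[OF H])
    with S show ?thesis by blast
  qed
qed

text \<open>It suffices to embed \<open>M\<close> in a known maximal subgroup. Without reflections
  this is \<open>rotations\<close>. With a reflection \<open>r\<^sup>j s\<close>, properness
  excludes \<open>r\<close>, so a prime \<open>p\<close> divides all rotation exponents and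
  \<open>dih_sub p j\<close> contains \<open>M\<close>.\<close>

lemma maximal_subgroup_dihedral_cases:
  assumes M: "maximal_subgroup M (dihedral_group n)"
  obtains "M = rotations" | p a where "p \<in> prime_factors n" "M = dih_sub p a"
proof (cases "\<exists>j. dih_elem n j True \<in> M")
  have sub: "subgroup M (dihedral_group n)" and proper: "M \<noteq> carrier (dihedral_group n)"
    and max: "\<And>H. maximal_subgroup H (dihedral_group n) \<Longrightarrow> M \<subseteq> H \<Longrightarrow> M = H"
    using M by (auto simp: maximal_subgroup_def)
  {
    case False
    have "M \<subseteq> rotations"
      unfolding dih_subset_iff[OF subgroup.subset[OF sub]] using False by auto
    then show ?thesis using max[OF maximal_rotations] that(1) by blast
  next
    case True
    then obtain j where j: "dih_elem n j True \<in> M" by blast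
    from sub show ?thesis
    proof (cases rule: subgroup_rotations_cases)
      case 1
      then show ?thesis using subgroup_eq_carrierI[OF sub _ j] proper by blast
    next
      case (2 p)
      then have p: "p dvd n" by (simp add: in_prime_factors_iff)
      have "dih_elem n i b \<in> dih_sub p j" if "dih_elem n i b \<in> M" for i b
        using 2(2)[of i] 2(2)[OF subgroup_diff[OF sub _ j], of i] that
        by (cases b) (auto simp: dih_elem_sub_iff p cong_0_iff cong_iff_dvd_diff)
      then have "M \<subseteq> dih_sub p j" by (simp add: dih_subset_iff subgroup.subset[OF sub])
      then show ?thesis using max[OF maximal_dih_sub[OF 2(1)]] that(2) 2(1) by blast
    qed
  }
qed

text \<open>The rotation \<open>r\<^sup>p\<close> lies in the first subgroup, and in the second only
  if \<open>q\<close> divides \<open>p\<close>. Consequently a family with one such subgroup per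
  prime has as many members as there are primes.\<close>

lemma dih_sub_eq_imp:
  assumes "p \<in> prime_factors n" "q \<in> prime_factors n" "dih_sub p a = dih_sub q b"
  shows "p = q"
proof -
  have "dih_elem n (int p) False \<in> dih_sub p a"
    using assms(1) by (simp add: dih_elem_sub_iff in_prime_factors_iff cong_0_iff)
  then have "q dvd p"
    using assms(2) unfolding assms(3) by (simp add: dih_elem_sub_iff in_prime_factors_iff cong_0_iff)
  then show ?thesis
    using assms primes_dvd_imp_eq[of q p] by (auto simp: in_prime_factors_iff)
qed

section \<open>The Frattini subgroup\<close>

lemma frattini_dihedral_iff:
  "dih_elem n i b \<in> frattini (dihedral_group n) \<longleftrightarrow> \<not> b \<and> (\<forall>p\<in>prime_factors n. int p dvd i)"
proof (intro iffI conjI ballI)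
  assume F: "dih_elem n i b \<in> frattini (dihedral_group n)"
  then show b: "\<not> b" using maximal_rotations by (auto simp: frattini_def)
  fix p assume p: "p \<in> prime_factors n"
  then have "dih_elem n i b \<in> dih_sub p 0"
    using F maximal_dih_sub by (auto simp: frattini_def)
  with p b show "int p dvd i" by (simp add: dih_elem_sub_iff in_prime_factors_iff cong_0_iff)
next
  assume i: "\<not> b \<and> (\<forall>p\<in>prime_factors n. int p dvd i)"
  have "dih_elem n i b \<in> M" if "maximal_subgroup M (dihedral_group n)" for M
    using that
  proof (cases rule: maximal_subgroup_dihedral_cases)
    case 1
    with i show ?thesis by simp
  next
    case (2 p a)
    with i show ?thesis by (simp add: dih_elem_sub_iff in_prime_factors_iff cong_0_iff)
  qed
  then show "dih_elem n i b \<in> frattini (dihedral_group n)" by (auto simp: frattini_def)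
qed

text \<open>This family attains the minimum. The residue 0 is an arbitrary choice:
  \<open>rotations\<close> removes all reflections, and on rotations \<open>dih_sub p a\<close>
  imposes the same condition for every \<open>a\<close>.\<close>

lemma frattini_dihedral_family:
  "carrier (dihedral_group n) \<inter> \<Inter> (insert rotations ((\<lambda>p. dih_sub p 0) ` prime_factors n)) =
    frattini (dihedral_group n)" (is "?L = ?R")
proof -
  have "dih_elem n i b \<in> ?L \<longleftrightarrow> dih_elem n i b \<in> ?R" for i b
    by (auto simp: frattini_dihedral_iff dih_elem_sub_iff in_prime_factors_iff cong_0_iff)
  moreover have L: "?L \<subseteq> carrier (dihedral_group n)" by (rule Int_lower1)
  moreover have R: "?R \<subseteq> carrier (dihedral_group n)"
    unfolding frattini_def by (rule Int_lower1)
  ultimately show ?thesis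
    unfolding set_eq_subset dih_subset_iff[OF L] dih_subset_iff[OF R] by blast
qed

section \<open>The size of families that intersect in the Frattini subgroup\<close>

lemma rotations_neq_dih_sub:
  assumes "p \<in> prime_factors n"
  shows "rotations \<noteq> dih_sub p a"
proof
  assume "rotations = dih_sub p a"
  moreover have "dih_elem n a True \<in> dih_sub p a"
    using assms by (simp add: dih_elem_sub_iff in_prime_factors_iff)
  ultimately show False by (metis dih_elem_rotations_iff)
qed

text \<open>Membership means that \<open>j\<close> is congruent to \<open>a p\<close> modulo each
  prime \<open>p\<close>, which the Chinese remainder theorem solves.\<close>

lemma prime_family_reflection:
  "\<exists>j. \<forall>p\<in>prime_factors n. dih_elem n j True \<in> dih_sub p (a p)"
proof -
  \<comment> \<open>The theorem is applied over the naturals, so the integer residues are first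
    reduced to nonnegative ones.\<close>
  have "\<exists>x. \<forall>p\<in>prime_factors n. [x = nat (a p mod int p)] (mod p)"
    by (rule chinese_remainder_nat) (auto intro: primes_coprime)
  then obtain x where x: "\<And>p. p \<in> prime_factors n \<Longrightarrow> [x = nat (a p mod int p)] (mod p)"
    by blast
  have "[int x = a p] (mod int p)" if "p \<in> prime_factors n" for p
  proof -
    have "p > 0" using that by (auto simp: in_prime_factors_iff prime_gt_0_nat)
    moreover have "[int x = int (nat (a p mod int p))] (mod int p)"
      using x[OF that] by (simp only: cong_int_iff)
    ultimately show ?thesis by (simp add: cong_def)
  qed
  then show ?thesis
    by (intro exI[of _ "int x"]) (simp add: dih_elem_sub_iff in_prime_factors_iff)
qed

lemma frattini_family_card_ge:
  assumes S: "S \<subseteq> {M. maximal_subgroup M (dihedral_group n)}" "finite S"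
    and I: "carrier (dihedral_group n) \<inter> \<Inter> S = frattini (dihedral_group n)"
  shows "card S \<ge> card (prime_factors n) + 1"
proof -
  have "\<exists>a. dih_sub p a \<in> S" if p: "p \<in> prime_factors n" for p
  proof (rule ccontr)
    assume none: "\<nexists>a. dih_sub p a \<in> S"
    \<comment> \<open>The rotation \<open>r\<^sup>m\<close> lies in \<open>rotations\<close> and in
      every \<open>dih_sub q a\<close> with \<open>q\<close> different from \<open>p\<close>, but
      not in the Frattini subgroup, since \<open>p\<close> does not divide \<open>m\<close>.\<close>
    define m where "m = \<Prod> (prime_factors n - {p})"
    have "dih_elem n (int m) False \<in> M" if "M \<in> S" for M
    proof -
      from S(1) that have "maximal_subgroup M (dihedral_group n)" by blast
      then show ?thesis
      proof (cases rule: maximal_subgroup_dihedral_cases)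
        case 1
        then show ?thesis by simp
      next
        case (2 q a)
        then have "q \<noteq> p" using none that by blast
        then have "q dvd m" unfolding m_def using 2(1) by (intro dvd_prodI) auto
        then show ?thesis using 2 by (simp add: dih_elem_sub_iff in_prime_factors_iff cong_0_iff)
      qed
    qed
    then have "dih_elem n (int m) False \<in> frattini (dihedral_group n)"
      unfolding I[symmetric] by auto
    then have "p dvd m" using p by (simp add: frattini_dihedral_iff)
    then obtain q where "q \<in> prime_factors n - {p}" "p dvd q"
      using p unfolding m_def by (subst (asm) prime_dvd_prod_iff) auto
    then show False using p primes_dvd_imp_eq[of p q] by (auto simp: in_prime_factors_iff)
  qed
  then obtain a where a: "\<And>p. p \<in> prime_factors n \<Longrightarrow> dih_sub p (a p) \<in> S" by metis
  \<comment> \<open>\<open>T\<close> picks one member of \<open>S\<close> for each prime. Its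
    members share a reflection, which the Frattini subgroup lacks, so \<open>T\<close> is a proper
    part of \<open>S\<close>.\<close>
  define T where "T = (\<lambda>p. dih_sub p (a p)) ` prime_factors n"
  have "inj_on (\<lambda>p. dih_sub p (a p)) (prime_factors n)"
    by (rule inj_onI) (rule dih_sub_eq_imp)
  then have card: "card T = card (prime_factors n)" unfolding T_def by (rule card_image)
  obtain j where j: "\<forall>p\<in>prime_factors n. dih_elem n j True \<in> dih_sub p (a p)"
    using prime_family_reflection[of a] by (elim exE)
  have "S \<noteq> T"
  proof
    assume "S = T"
    then have "dih_elem n j True \<in> frattini (dihedral_group n)"
      unfolding I[symmetric] using j by (auto simp: T_def)
    then show False by (simp add: frattini_dihedral_iff)
  qed
  then have "T \<subset> S" using a by (auto simp: T_def)
  then have "card T < card S" by (rule psubset_card_mono[OF S(2)])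
  then show ?thesis unfolding card by linarith
qed

lemma intersection_number_dihedral:
  "intersection_number (dihedral_group n) = card (prime_factors n) + 1"
  unfolding intersection_number_def
proof (rule Least_equality)
  let ?S = "insert rotations ((\<lambda>p. dih_sub p 0) ` prime_factors n)"
  have "inj_on (\<lambda>p. dih_sub p 0) (prime_factors n)"
    by (rule inj_onI) (rule dih_sub_eq_imp)
  then have "card ?S = card (prime_factors n) + 1"
    using rotations_neq_dih_sub by (subst card_insert_disjoint) (auto simp: card_image)
  moreover have "?S \<subseteq> {M. maximal_subgroup M (dihedral_group n)}"
    using maximal_rotations maximal_dih_sub by blast
  moreover have "finite ?S" by simp
  ultimately show "\<exists>S. S \<subseteq> {M. maximal_subgroup M (dihedral_group n)} \<and> finite S \<and>
      card S = card (prime_factors n) + 1 \<and>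
      carrier (dihedral_group n) \<inter> \<Inter> S = frattini (dihedral_group n)"
    using frattini_dihedral_family by (intro exI[of _ ?S] conjI)
  show "card (prime_factors n) + 1 \<le> m"
    if "\<exists>S. S \<subseteq> {M. maximal_subgroup M (dihedral_group n)} \<and> finite S \<and>
      card S = m \<and> carrier (dihedral_group n) \<inter> \<Inter> S = frattini (dihedral_group n)" for m
    using that frattini_family_card_ge by metis
qed

end

section \<open>Translation from the given factorization\<close>

lemma prime_factors_prod_prime_powers:
  fixes p e :: "'a \<Rightarrow> nat"
  assumes "finite A" "\<And>i. i \<in> A \<Longrightarrow> prime (p i)" "\<And>i. i \<in> A \<Longrightarrow> e i > 0"
  shows "prime_factors (\<Prod>i\<in>A. p i ^ e i) = p ` A"
proof -
  have "prime_factors (\<Prod>i\<in>A. p i ^ e i) = (\<Union>i\<in>A. prime_factors (p i ^ e i))"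
    using assms by (subst prime_factors_prod) (auto dest!: prime_gt_0_nat, force)
  also have "\<dots> = (\<Union>i\<in>A. {p i})"
    using assms by (intro SUP_cong) (auto simp: prime_factorization_prime_power)
  finally show ?thesis by auto
qed

theorem proposition4p1:
  fixes n k :: nat and p e :: "nat \<Rightarrow> nat"
  assumes "n \<ge> 3"
    and "\<And>i. i \<in> {1..k} \<Longrightarrow> prime (p i)"
    and "inj_on p {1..k}"
    and "\<And>i. i \<in> {1..k} \<Longrightarrow> e i > 0"
    and "n = (\<Prod>i = 1..k. p i ^ e i)"
  shows "intersection_number (dihedral_group n) = k + 1"
proof -
  have "prime_factors n = p ` {1..k}"
    unfolding assms(5) using assms(2,4) by (intro prime_factors_prod_prime_powers) auto
  \<comment> \<open>Distinctness of the primes makes the number of prime factors exactly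
    \<open>k\<close>.\<close>
  then have "card (prime_factors n) = k" using card_image[OF assms(3)] by simp
  then show ?thesis using intersection_number_dihedral assms(1) by simp
qed

end
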